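(* Let $S=\{1,\dots,s\}$, and for each $n\ge0$ and $i\in S$ let $D_i(n)\subset S\setminus\{i\}$ be given sets such that $j\in D_i(n)$ if and only if $i\in D_j(n)$. Put $d_i(n)=|D_i(n)|$ and consider the JLM model $$\theta_i(n+1)=\frac{1}{1+d_i(n)}\Big[\theta_i(n)+\sum_{j\in D_i(n)}\theta_j(n)\Big],\qquad i\in S,\ n\ge 0 .$$ Then, without any additional assumption, the transition chain of this model is class-ergodic; in other words, unconditional multiple consensus occurs: for every initial time $k\ge0$ and all initial values $\theta_1(k),\dots,\theta_s(k)\in\mathbb{R}$, $\lim_{n\to\infty}\theta_i(n)$ exists for every $i\in S$.
   Context: The transition chain is the sequence of row stochastic matrices $A_n=(a_{ij}(n))$ with $a_{ij}(n)=\frac{1}{1+d_i(n)}$ if $j=i$ or $j\in D_i(n)$, and $a_{ij}(n)=0$ otherwise. The sets $D_i(n)$ of neighbors are pre-defined (they do not depend on the states). For $n>k\ge 0$ let $A(n,k)=A_{n-1}A_{n-2}\cdots A_k$. A chain $(A_n)$ of row stochastic matrices (nonnegative entries, each row summing to $1$) is class-ergodic if for every $k\ge 0$ the limit $\lim_{n\to\infty}A(n,k)$ exists and can be relabeled (by renumbering the indices $1,\dots,s$) as a block diagonal matrix with constant rows, i.e. the rows within each diagonal block are identical.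
   Formalization: Block structure of the limits is claimed only for initial times from some K on, since it can fail earlier (s=3, links {1,2},{2,3} at time 0 only); existence of the limits of A(n,k) and of all θ_i(n) is proved for every k. *)

theory Defs
  imports "HOL-Analysis.Analysis"
begin

definition row_stochastic :: "real^'s^'s \<Rightarrow> bool" where
  "row_stochastic M \<longleftrightarrow> (\<forall>i j. 0 \<le> M $ i $ j) \<and> (\<forall>i. (\<Sum>j\<in>UNIV. M $ i $ j) = 1)"

(* backward_prod A n k = A (n - 1) ** ... ** A k for n > k.  Every empty product is the
   identity matrix, so limits in n only see the values with n > k. *)
primrec backward_prod :: "(nat \<Rightarrow> real^'s^'s) \<Rightarrow> nat \<Rightarrow> nat \<Rightarrow> real^'s^'s" where
  "backward_prod A 0 k = mat 1"
| "backward_prod A (Suc n) k = (if k \<le> n then A n ** backward_prod A n k else mat 1)"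

(* After the renumbering \<sigma> of the indices by 1, ..., s, the diagonal blocks occupy the
   consecutive index ranges {c r<..c (Suc r)} for r < m: entries outside the diagonal blocks
   vanish, and the rows within each diagonal block are identical. *)
definition relabels_to_const_row_blocks :: "real^'s^'s \<Rightarrow> bool" where
  "relabels_to_const_row_blocks L \<longleftrightarrow>
     (\<exists>(\<sigma> :: nat \<Rightarrow> 's) (m :: nat) (c :: nat \<Rightarrow> nat).
        bij_betw \<sigma> {1..CARD('s)} UNIV \<and>
        c 0 = 0 \<and> c m = CARD('s) \<and> (\<forall>r<m. c r < c (Suc r)) \<and>
        (\<forall>r<m. \<forall>p\<in>{c r<..c (Suc r)}.
           (\<forall>q\<in>{1..CARD('s)} - {c r<..c (Suc r)}. L $ \<sigma> p $ \<sigma> q = 0) \<and>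
           (\<forall>p'\<in>{c r<..c (Suc r)}. \<forall>q\<in>{c r<..c (Suc r)}.
              L $ \<sigma> p $ \<sigma> q = L $ \<sigma> p' $ \<sigma> q)))"

definition class_ergodic :: "(nat \<Rightarrow> real^'s^'s) \<Rightarrow> bool" where
  "class_ergodic A \<longleftrightarrow>
     (\<forall>n. row_stochastic (A n)) \<and>
     (\<forall>k. \<exists>L. (\<lambda>n. backward_prod A n k) \<longlonglongrightarrow> L \<and> relabels_to_const_row_blocks L)"

definition jlm_chain :: "(nat \<Rightarrow> 's \<Rightarrow> 's set) \<Rightarrow> nat \<Rightarrow> real^'s^'s" where
  "jlm_chain D n =
     (\<chi> i j. if j = i \<or> j \<in> D n i then 1 / (1 + real (card (D n i))) else 0)"

definition jlm_trajectory :: "(nat \<Rightarrow> 's \<Rightarrow> 's set) \<Rightarrow> nat \<Rightarrow> (nat \<Rightarrow> real^'s) \<Rightarrow> bool" where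
  "jlm_trajectory D k \<theta> \<longleftrightarrow>
     (\<forall>n\<ge>k. \<forall>i. \<theta> (Suc n) $ i =
        1 / (1 + real (card (D n i))) * (\<theta> n $ i + (\<Sum>j\<in>D n i. \<theta> n $ j)))"

(* Pitfall: class_ergodic asks for the block structure at every starting time k, and a JLM
   chain can violate this at early k.  With three agents, neighbor pairs {1,2} and {2,3} at
   time 0 and no neighbors later, the limit for k = 0 is
     1/2 1/2  0
     1/3 1/3 1/3
      0  1/2 1/2
   which no renumbering brings to the required form.  Statements about a JLM chain therefore
   have to separate the existence of the limits, for every k, from the class-ergodicity of
   a tail of the chain, started at some time K. *)

end

theory Submission
  imports Defs
begin

text \<open>
  Join two agents if they are neighbors infinitely often, and consider the connected components
  of this graph; from some time on, all edges lie inside components.  Within a component \<open>C\<close>, let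
  \<open>b\<close> be the current maximum and suppose that the values on \<open>S \<subset> C\<close> are at most \<open>b - g\<close>.  By
  symmetry, the bound on \<open>S\<close> persists until the next edge between \<open>S\<close> and \<open>C - S\<close>, however long
  that takes.  At that moment the agents of \<open>S\<close> (because of their own weight) and the newly
  joined ones get values at most \<open>b - \<delta> g\<close>, where \<open>\<delta> = 1/s\<close> bounds the positive weights from
  below.  Starting at a minimal agent, \<open>S\<close> exhausts \<open>C\<close> after fewer than \<open>s\<close> such moments, so that
  the maximum has dropped by a fixed fraction of the oscillation.  Hence the limits of the maximum
  and of the minimum over \<open>C\<close> agree.
\<close>

section \<open>Chains with symmetric zero pattern\<close>

lemma weighted_average_le:
  fixes w y :: "'a::finite \<Rightarrow> real"
  assumes nonneg: "\<And>j. 0 \<le> w j" and sum1: "(\<Sum>j\<in>UNIV. w j) = 1"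
    and le: "\<And>j. w j \<noteq> 0 \<Longrightarrow> y j \<le> b"
  shows "(\<Sum>j\<in>UNIV. w j * y j) \<le> b"
proof -
  have "(\<Sum>j\<in>UNIV. w j * y j) \<le> (\<Sum>j\<in>UNIV. w j * b)"
  proof (rule sum_mono)
    fix j show "w j * y j \<le> w j * b"
      using nonneg[of j] le[of j] by (cases "w j = 0") (auto intro: mult_left_mono)
  qed
  then show ?thesis using sum1 by (simp flip: sum_distrib_right)
qed

text \<open>Raising the entry at \<open>j0\<close> by \<open>g\<close> keeps every entry of nonzero
  weight at most \<open>b\<close>, so the plain bound applies to the raised vector. The raise adds
  at least \<open>\<delta> * g\<close> to the average.\<close>

lemma weighted_average_le_gap:
  fixes w y :: "'a::finite \<Rightarrow> real"
  assumes nonneg: "\<And>j. 0 \<le> w j" and sum1: "(\<Sum>j\<in>UNIV. w j) = 1"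
    and le: "\<And>j. w j \<noteq> 0 \<Longrightarrow> y j \<le> b"
    and j0: "\<delta> \<le> w j0" "y j0 \<le> b - g" and "0 \<le> g"
  shows "(\<Sum>j\<in>UNIV. w j * y j) \<le> b - \<delta> * g"
proof -
  have "(\<Sum>j\<in>UNIV. w j * (if j = j0 then y j + g else y j)) \<le> b"
    using le j0 by (intro weighted_average_le nonneg sum1) auto
  also have "(\<Sum>j\<in>UNIV. w j * (if j = j0 then y j + g else y j))
      = (\<Sum>j\<in>UNIV. w j * y j + (if j = j0 then w j0 * g else 0))"
    by (rule sum.cong) (auto simp: algebra_simps)
  also have "\<dots> = (\<Sum>j\<in>UNIV. w j * y j) + w j0 * g"
    by (simp add: sum.distrib)
  finally show ?thesis
    using mult_right_mono[OF j0(1) \<open>0 \<le> g\<close>] by simp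
qed

section \<open>Recurrent links\<close>

text \<open>The closure is directed. For a symmetric zero pattern it is an equivalence relation
  (\<open>equiv_recurrently_linked\<close>), whose classes are the components.\<close>

definition recurrently_linked :: "(nat \<Rightarrow> real^'s^'s) \<Rightarrow> ('s \<times> 's) set" where
  "recurrently_linked A = {(i, j). \<exists>\<^sub>\<infinity>n. A n $ i $ j \<noteq> 0}\<^sup>*"

text \<open>What happens infinitely often does not depend on finitely many times. This lets a tail
  be treated with the classes of the whole chain.\<close>

lemma recurrently_linked_shift:
  "recurrently_linked (\<lambda>n. A (K + n)) = recurrently_linked A"
proof -
  have "(\<exists>\<^sub>\<infinity>n. A (K + n) $ i $ j \<noteq> 0) \<longleftrightarrow> (\<exists>\<^sub>\<infinity>n. A n $ i $ j \<noteq> 0)" for i j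
    unfolding frequently_def cofinite_eq_sequentially
    using eventually_sequentially_seg[of "\<lambda>n. A n $ i $ j = 0" K] by (simp add: add.commute)
  then show ?thesis unfolding recurrently_linked_def by simp
qed

text \<open>A pair that is not linked infinitely often has no link after some time, and there are
  only finitely many pairs.\<close>

lemma eventually_recurrently_linked:
  fixes A :: "nat \<Rightarrow> real^'s::finite^'s"
  shows "\<exists>K. \<forall>n\<ge>K. \<forall>i j. A n $ i $ j \<noteq> 0 \<longrightarrow> (i, j) \<in> recurrently_linked A"
proof -
  have "\<forall>\<^sub>F n in sequentially. A n $ i $ j \<noteq> 0 \<longrightarrow> (i, j) \<in> recurrently_linked A" for i j
  proof (cases "\<exists>\<^sub>\<infinity>n. A n $ i $ j \<noteq> 0")
    case True
    then have "(i, j) \<in> recurrently_linked A" unfolding recurrently_linked_def by auto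
    then show ?thesis by simp
  next
    case False
    then have "\<forall>\<^sub>F n in sequentially. A n $ i $ j = 0"
      by (simp add: frequently_def cofinite_eq_sequentially)
    then show ?thesis by eventually_elim simp
  qed
  then have "\<forall>\<^sub>F n in sequentially. \<forall>i j. A n $ i $ j \<noteq> 0 \<longrightarrow> (i, j) \<in> recurrently_linked A"
    by (intro eventually_all_finite)
  then show ?thesis by (simp add: eventually_sequentially)
qed

section \<open>One-step bounds and their persistence\<close>

text \<open>Only the zero pattern is symmetric; the weights of the two directions may differ.
  Applying \<open>sym\<close> twice shows that every nonzero entry is at least \<delta>.\<close>

locale symmetric_pattern_chain =
  fixes A :: "nat \<Rightarrow> real^'s::finite^'s" and \<delta> :: real
  assumes stochastic: "row_stochastic (A n)"
    and \<delta>_pos: "0 < \<delta>"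
    and diag: "\<delta> \<le> A n $ i $ i"
    and sym: "A n $ i $ j \<noteq> 0 \<Longrightarrow> \<delta> \<le> A n $ j $ i"
begin

lemma sym_iff: "A n $ i $ j \<noteq> 0 \<longleftrightarrow> A n $ j $ i \<noteq> 0"
  using sym[of n i j] sym[of n j i] \<delta>_pos by (metis not_less)

lemma nonneg: "0 \<le> A n $ i $ j" and row_sum: "(\<Sum>j\<in>UNIV. A n $ i $ j) = 1"
  using stochastic[of n] by (auto simp: row_stochastic_def)

lemma \<delta>_le_1: "\<delta> \<le> 1"
proof -
  have "A 0 $ i $ i \<le> (\<Sum>j\<in>UNIV. A 0 $ i $ j)" for i
    by (rule member_le_sum) (auto simp: nonneg)
  then show ?thesis using diag[of 0] row_sum[of 0] by (metis order_trans)
qed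

lemma shift: "symmetric_pattern_chain (\<lambda>n. A (K + n)) \<delta>"
  by unfold_locales (auto intro: stochastic \<delta>_pos diag sym)

lemma step_le:
  assumes "\<And>j. A n $ i $ j \<noteq> 0 \<Longrightarrow> v $ j \<le> b"
  shows "(A n *v v) $ i \<le> b"
  unfolding matrix_vector_mult_def
  using assms by (auto intro!: weighted_average_le nonneg row_sum)

lemma step_le_gap:
  assumes "\<And>j. A n $ i $ j \<noteq> 0 \<Longrightarrow> v $ j \<le> b"
    and "\<delta> \<le> A n $ i $ j0" "v $ j0 \<le> b - g" "0 \<le> g"
  shows "(A n *v v) $ i \<le> b - \<delta> * g"
  unfolding matrix_vector_mult_def
  using assms by (auto intro!: weighted_average_le_gap[where ?j0.0 = j0] nonneg row_sum)

lemma equiv_recurrently_linked: "equiv UNIV (recurrently_linked A)"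
proof -
  have "sym {(i, j). \<exists>\<^sub>\<infinity>n. A n $ i $ j \<noteq> 0}"
    unfolding Relation.sym_def using sym_iff by simp
  then show ?thesis
    unfolding recurrently_linked_def
    by (auto intro!: equivI refl_rtrancl sym_rtrancl trans_rtrancl)
qed

text \<open>From time \<open>k\<close> on, the rows of \<open>C\<close> average over values in
  \<open>C\<close> only, so a bound on \<open>C\<close> passes from each step to the next.\<close>

lemma upper_bound_persists:
  assumes trajectory: "\<And>n. k \<le> n \<Longrightarrow> x (Suc n) = A n *v x n"
    and closed: "\<And>n i j. k \<le> n \<Longrightarrow> i \<in> C \<Longrightarrow> A n $ i $ j \<noteq> 0 \<Longrightarrow> j \<in> C"
    and "k \<le> n" "n \<le> n'" "\<And>i. i \<in> C \<Longrightarrow> x n $ i \<le> b" "i \<in> C"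
  shows "x n' $ i \<le> b"
  using \<open>n \<le> n'\<close> \<open>i \<in> C\<close>
proof (induction n' arbitrary: i rule: dec_induct)
  case base
  then show ?case using assms(5) by blast
next
  case (step m)
  then have "k \<le> m" using assms(3) by simp
  then have "(A m *v x m) $ i \<le> b"
    using step.IH step.prems closed by (intro step_le) blast
  then show ?case using trajectory \<open>k \<le> m\<close> by simp
qed

lemma lower_bound_persists:
  assumes trajectory: "\<And>n. k \<le> n \<Longrightarrow> x (Suc n) = A n *v x n"
    and closed: "\<And>n i j. k \<le> n \<Longrightarrow> i \<in> C \<Longrightarrow> A n $ i $ j \<noteq> 0 \<Longrightarrow> j \<in> C"
    and "k \<le> n" "n \<le> n'" "\<And>i. i \<in> C \<Longrightarrow> b \<le> x n $ i" "i \<in> C"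
  shows "b \<le> x n' $ i"
proof -
  have "(- x n') $ i \<le> - b"
  proof (rule upper_bound_persists[where x = "\<lambda>n. - x n", OF _ closed \<open>k \<le> n\<close> \<open>n \<le> n'\<close> _ \<open>i \<in> C\<close>])
    show "- x (Suc n) = A n *v (- x n)" if "k \<le> n" for n
      using trajectory[OF that] by (simp add: matrix_vector_mult_def vec_eq_iff sum_negf)
    show "(- x n) $ j \<le> - b" if "j \<in> C" for j
      using assms(5)[OF that] by simp
  qed
  then show ?thesis by simp
qed

section \<open>Consensus within one component\<close>

text \<open>The assumption \<open>crossing\<close> is the form of connectedness that the argument
  uses: beyond any time, every proper nonempty part of \<open>C\<close> is again linked to the rest
  of \<open>C\<close>.\<close>

context
  fixes x :: "nat \<Rightarrow> real^'s" and k :: nat and C :: "'s set"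
  assumes trajectory: "\<And>n. k \<le> n \<Longrightarrow> x (Suc n) = A n *v x n"
    and closed: "\<And>n i j. k \<le> n \<Longrightarrow> i \<in> C \<Longrightarrow> A n $ i $ j \<noteq> 0 \<Longrightarrow> j \<in> C"
    and crossing: "\<And>n S. S \<noteq> {} \<Longrightarrow> S \<subset> C \<Longrightarrow> \<exists>n'\<ge>n. \<exists>i\<in>S. \<exists>j\<in>C - S. A n' $ i $ j \<noteq> 0"
begin

lemma low_set_grows:
  assumes "k \<le> n" "\<And>i. i \<in> C \<Longrightarrow> x n $ i \<le> b" "0 \<le> g"
    and S: "S \<noteq> {}" "S \<subset> C" "\<And>i. i \<in> S \<Longrightarrow> x n $ i \<le> b - g"
  shows "\<exists>n'\<ge>n. \<exists>S'. S \<subset> S' \<and> S' \<subseteq> C \<and> (\<forall>i\<in>S'. x n' $ i \<le> b - \<delta> * g)"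
proof -
  define crosses where "crosses m \<longleftrightarrow> n \<le> m \<and> (\<exists>i\<in>S. \<exists>j\<in>C - S. A m $ i $ j \<noteq> 0)" for m
  \<comment> \<open>At the first crossing the bound on \<open>S\<close> still holds in full, so the
    gap shrinks once per enlargement of \<open>S\<close> and not once per time step.\<close>
  define t where "t = (LEAST m. crosses m)"
  have "\<exists>m. crosses m" using crossing[OF S(1,2), of n] unfolding crosses_def by blast
  then have "crosses t" unfolding t_def by (rule LeastI_ex)
  then obtain i0 j0 where t: "n \<le> t" "i0 \<in> S" "j0 \<in> C - S" "A t $ i0 $ j0 \<noteq> 0"
    unfolding crosses_def by blast
  have before: "\<not> crosses m" if "m < t" for m
    using that not_less_Least unfolding t_def by blast
  have low: "x m $ i \<le> b - g" if "n \<le> m" "m \<le> t" "i \<in> S" for m i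
    using that
  proof (induction m arbitrary: i rule: dec_induct)
    case base
    then show ?case using S(3) by blast
  next
    case (step m)
    \<comment> \<open>Before \<open>t\<close> no link leads from \<open>S\<close> to
      \<open>C - S\<close>, and \<open>closed\<close> keeps links inside \<open>C\<close>, so row
      \<open>i\<close> averages over \<open>S\<close> alone.\<close>
    have "j \<in> S" if "A m $ i $ j \<noteq> 0" for j
      using before[of m] step.hyps step.prems closed[of m i j] that \<open>k \<le> n\<close> S(2)
      unfolding crosses_def by auto
    then have "(A m *v x m) $ i \<le> b - g"
      using step.IH step.prems by (intro step_le) auto
    then show ?case
      using step.hyps \<open>k \<le> n\<close> by (simp add: trajectory)
  qed
  have bound: "x t $ i \<le> b" if "i \<in> C" for i
    using upper_bound_persists[OF trajectory closed assms(1) t(1) assms(2) that] .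
  have drop: "x (Suc t) $ i \<le> b - \<delta> * g" if "i \<in> C" "j \<in> S" "\<delta> \<le> A t $ i $ j" for i j
  proof -
    have "k \<le> t" using t(1) \<open>k \<le> n\<close> by simp
    have "(A t *v x t) $ i \<le> b - \<delta> * g"
    proof (rule step_le_gap)
      show "x t $ l \<le> b" if "A t $ i $ l \<noteq> 0" for l
        using bound closed[OF \<open>k \<le> t\<close> \<open>i \<in> C\<close> that] .
      show "x t $ j \<le> b - g" using low t(1) \<open>j \<in> S\<close> by simp
    qed fact+
    then show ?thesis using trajectory[OF \<open>k \<le> t\<close>] by simp
  qed
  define S' where "S' = insert j0 S"
  have "x (Suc t) $ i \<le> b - \<delta> * g" if "i \<in> S'" for i
  proof (cases "i = j0")
    case True
    \<comment> \<open>The crossing provides the entry from \<open>i0\<close> to \<open>j0\<close>,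
      while \<open>j0\<close> is pulled down by the reverse entry; here symmetry of the pattern
      enters.\<close>
    then show ?thesis using drop[of j0 i0] t sym[of t i0 j0] by auto
  next
    case False
    then show ?thesis using drop[of i i] that S(2) diag[of t i] unfolding S'_def by auto
  qed
  moreover have "S \<subset> S'" "S' \<subseteq> C" using t S(2) unfolding S'_def by auto
  moreover have "n \<le> Suc t" using t(1) by simp
  ultimately show ?thesis by blast
qed

text \<open>Each enlargement of \<open>S\<close> costs a factor \<delta> of the gap and takes at
  least one agent out of \<open>C - S\<close>, while the bound \<open>b\<close> on \<open>C\<close>
  persists. Hence the induction is on a bound \<open>p\<close> for the number of agents still
  missing.\<close>

lemma low_set_exhausts:
  assumes "k \<le> n" "\<And>i. i \<in> C \<Longrightarrow> x n $ i \<le> b" "0 \<le> g"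
    and "S \<noteq> {}" "S \<subseteq> C" "\<And>i. i \<in> S \<Longrightarrow> x n $ i \<le> b - g" "card (C - S) \<le> p"
  shows "\<exists>n'\<ge>n. \<forall>i\<in>C. x n' $ i \<le> b - \<delta> ^ p * g"
  using assms
proof (induction p arbitrary: n g S)
  case 0
  then have "S = C" by auto
  then show ?case using 0 by auto
next
  case (Suc p)
  show ?case
  proof (cases "S = C")
    case True
    \<comment> \<open>\<open>S\<close> may fill \<open>C\<close> before \<open>p\<close> is used up;
      as \<delta> \<le> 1, the remaining factors only weaken the bound.\<close>
    have "\<delta> ^ Suc p * g \<le> g"
      using \<delta>_pos \<delta>_le_1 \<open>0 \<le> g\<close> power_le_one[of \<delta> "Suc p"] by (simp add: mult_left_le_one_le)
    then show ?thesis using True Suc.prems(6) by fastforce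
  next
    case False
    then have "S \<subset> C" using Suc.prems by blast
    from low_set_grows[OF Suc.prems(1-4) this Suc.prems(6)]
    obtain t S' where t: "n \<le> t" "S \<subset> S'" "S' \<subseteq> C" "\<And>i. i \<in> S' \<Longrightarrow> x t $ i \<le> b - \<delta> * g"
      by blast
    have "card (C - S') < card (C - S)"
      using t by (intro psubset_card_mono) auto
    then have "card (C - S') \<le> p" using Suc.prems(7) by simp
    moreover have "x t $ i \<le> b" if "i \<in> C" for i
      using upper_bound_persists[OF trajectory closed Suc.prems(1) t(1) Suc.prems(2) that] .
    moreover have "k \<le> t" "0 \<le> \<delta> * g" "S' \<noteq> {}"
      using Suc.prems(1,3) t(1,2) \<delta>_pos by auto
    ultimately have "\<exists>n'\<ge>t. \<forall>i\<in>C. x n' $ i \<le> b - \<delta> ^ p * (\<delta> * g)"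
      using t(3,4) by (intro Suc.IH[of t "\<delta> * g" S'])
    then show ?thesis using t(1) by (auto simp: mult_ac intro: order_trans)
  qed
qed

text \<open>The maximum decreases and the minimum increases, so both converge. The drop of the
  maximum by a fixed fraction of the oscillation survives in the limit and forces the two limits to
  agree.\<close>

lemma consensus:
  assumes "C \<noteq> {}"
  shows "\<exists>c. \<forall>i\<in>C. (\<lambda>n. x n $ i) \<longlonglongrightarrow> c"
proof -
  define M where "M n = Max ((\<lambda>i. x (n + k) $ i) ` C)" for n
  define m where "m n = Min ((\<lambda>i. x (n + k) $ i) ` C)" for n
  have le_M: "x (n + k) $ i \<le> M n" and m_le: "m n \<le> x (n + k) $ i" if "i \<in> C" for n i
    using that unfolding M_def m_def by auto
  have M_le: "M n \<le> b" if "\<And>i. i \<in> C \<Longrightarrow> x (n + k) $ i \<le> b" for n b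
    unfolding M_def using that assms by auto
  have le_m: "b \<le> m n" if "\<And>i. i \<in> C \<Longrightarrow> b \<le> x (n + k) $ i" for n b
    unfolding m_def using that assms by auto
  have dec: "decseq M"
  proof (rule decseq_SucI, rule M_le)
    fix n i assume "i \<in> C"
    show "x (Suc n + k) $ i \<le> M n"
      by (rule upper_bound_persists[OF trajectory closed _ _ le_M \<open>i \<in> C\<close>]) auto
  qed
  have inc: "incseq m"
  proof (rule incseq_SucI, rule le_m)
    fix n i assume "i \<in> C"
    show "m n \<le> x (Suc n + k) $ i"
      by (rule lower_bound_persists[OF trajectory closed _ _ m_le \<open>i \<in> C\<close>]) auto
  qed
  have m_le_M: "m n \<le> M n'" for n n'
  proof -
    \<comment> \<open>Different times are compared at the later one. This bounds each of the two
      monotone sequences by a value of the other.\<close>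
    have "m n \<le> m (max n n')" using inc by (simp add: incseq_def)
    also have "\<dots> \<le> M (max n n')" using assms le_M m_le order_trans by blast
    also have "\<dots> \<le> M n'" using dec by (simp add: decseq_def)
    finally show ?thesis .
  qed
  obtain Ml where Ml: "M \<longlonglongrightarrow> Ml"
    by (rule decseq_convergent[OF dec, of "m 0"]) (simp_all add: m_le_M)
  obtain ml where ml: "m \<longlonglongrightarrow> ml"
    by (rule incseq_convergent[OF inc, of "M 0"]) (simp_all add: m_le_M)
  \<comment> \<open>\<open>low_set_exhausts\<close> is started with one agent attaining the minimum,
    so the gap is the whole oscillation; \<open>card C\<close> bounds the number of
    enlargements.\<close>
  have drop: "Ml \<le> M n - \<delta> ^ card C * (M n - m n)" for n
  proof -
    have "m n \<in> (\<lambda>i. x (n + k) $ i) ` C"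
      unfolding m_def using assms by (intro Min_in) auto
    then obtain i where i: "i \<in> C" "x (n + k) $ i = m n" by auto
    have "\<exists>n'\<ge>n + k. \<forall>i\<in>C. x n' $ i \<le> M n - \<delta> ^ card C * (M n - m n)"
    proof (rule low_set_exhausts[where S = "{i}"])
      show "0 \<le> M n - m n" using m_le_M by simp
      show "x (n + k) $ j \<le> M n - (M n - m n)" if "j \<in> {i}" for j
        using i(2) that by simp
      show "card (C - {i}) \<le> card C" by (intro card_mono) auto
    qed (use i(1) le_M in auto)
    then obtain n' where "n' \<ge> n + k" "\<And>i. i \<in> C \<Longrightarrow> x n' $ i \<le> M n - \<delta> ^ card C * (M n - m n)"
      by blast
    then have "M (n' - k) \<le> M n - \<delta> ^ card C * (M n - m n)"
      by (intro M_le) simp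
    then show ?thesis using decseq_ge[OF dec Ml, of "n' - k"] by simp
  qed
  have "(\<lambda>n. M n - \<delta> ^ card C * (M n - m n)) \<longlonglongrightarrow> Ml - \<delta> ^ card C * (Ml - ml)"
    by (intro tendsto_intros Ml ml)
  then have "Ml \<le> Ml - \<delta> ^ card C * (Ml - ml)"
    using drop by (intro LIMSEQ_le_const) auto
  then have "\<delta> ^ card C * (Ml - ml) \<le> 0" by simp
  then have "Ml \<le> ml"
    using zero_less_power[OF \<delta>_pos] by (metis diff_gt_0_iff_gt mult_pos_pos not_le)
  moreover have "ml \<le> Ml" using LIMSEQ_le[OF ml Ml] m_le_M by blast
  ultimately have "ml = Ml" by simp
  have "(\<lambda>n. x n $ i) \<longlonglongrightarrow> Ml" if "i \<in> C" for i
  proof -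
    have "(\<lambda>n. x (n + k) $ i) \<longlonglongrightarrow> Ml"
      by (rule tendsto_sandwich[OF _ _ ml[unfolded \<open>ml = Ml\<close>] Ml]) (simp_all add: le_M m_le that)
    then show ?thesis by (rule LIMSEQ_offset)
  qed
  then show ?thesis by blast
qed

end

section \<open>Limits of trajectories and of backward products\<close>

theorem trajectory_limits:
  assumes trajectory: "\<And>n. k \<le> n \<Longrightarrow> x (Suc n) = A n *v x n"
  shows "\<exists>l. (\<forall>i. (\<lambda>n. x n $ i) \<longlonglongrightarrow> l i) \<and> (\<forall>(i, j)\<in>recurrently_linked A. l i = l j)"
proof -
  let ?R = "recurrently_linked A"
  obtain K where K: "\<And>n i j. K \<le> n \<Longrightarrow> A n $ i $ j \<noteq> 0 \<Longrightarrow> (i, j) \<in> ?R"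
    using eventually_recurrently_linked by blast
  have class_limit: "\<exists>c. \<forall>j\<in>?R `` {i}. (\<lambda>n. x n $ j) \<longlonglongrightarrow> c" for i
  proof (rule consensus[where k = "max k K"])
    fix n assume "max k K \<le> n"
    then show "x (Suc n) = A n *v x n" using trajectory by simp
  next
    fix n a b assume "max k K \<le> n" "a \<in> ?R `` {i}" "A n $ a $ b \<noteq> 0"
    then show "b \<in> ?R `` {i}"
      using K[of n a b] equiv_recurrently_linked by (auto elim!: equivE dest: transD)
  next
    fix n :: nat and S assume S: "S \<noteq> {}" "S \<subset> ?R `` {i}"
    then obtain a b where "a \<in> S" "b \<in> ?R `` {i} - S" by blast
    then have "(a, b) \<in> ?R"
      using S(2) equiv_recurrently_linked by (auto elim!: equivE dest: transD symD)
    \<comment> \<open>A path of recurrent links from \<open>a\<close> inside \<open>S\<close> to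
      \<open>b\<close> outside must contain a link that leaves \<open>S\<close>.\<close>
    then have "\<exists>p q. p \<in> S \<and> q \<notin> S \<and> (\<exists>\<^sub>\<infinity>n. A n $ p $ q \<noteq> 0)"
      using \<open>a \<in> S\<close> \<open>b \<in> _ - S\<close> unfolding recurrently_linked_def
      by (induction rule: converse_rtrancl_induct) auto
    then obtain p q where pq: "p \<in> S" "q \<notin> S" "\<exists>\<^sub>\<infinity>n. A n $ p $ q \<noteq> 0" by blast
    then have "(p, q) \<in> ?R" unfolding recurrently_linked_def by auto
    then have "q \<in> ?R `` {i}"
      using pq(1) S(2) equiv_recurrently_linked by (auto elim!: equivE dest: transD)
    moreover obtain n' where "n' \<ge> n" "A n' $ p $ q \<noteq> 0"
      using pq(3) by (auto simp: INFM_nat_le)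
    ultimately show "\<exists>n'\<ge>n. \<exists>a\<in>S. \<exists>b\<in>?R `` {i} - S. A n' $ a $ b \<noteq> 0"
      using pq by blast
  next
    show "?R `` {i} \<noteq> {}"
      using equiv_recurrently_linked by (auto elim!: equivE dest: refl_onD)
  qed
  \<comment> \<open>The constant in \<open>class_limit\<close> is chosen anew for each
    \<open>i\<close>; \<open>lim\<close> fixes one value per agent, and uniqueness of limits makes
    it constant on classes.\<close>
  define l where "l i = lim (\<lambda>n. x n $ i)" for i
  have l: "(\<lambda>n. x n $ j) \<longlonglongrightarrow> l i" if "(i, j) \<in> ?R" for i j
  proof -
    obtain c where c: "\<And>j. (i, j) \<in> ?R \<Longrightarrow> (\<lambda>n. x n $ j) \<longlonglongrightarrow> c"
      using class_limit[of i] by auto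
    have "(i, i) \<in> ?R" using equiv_recurrently_linked by (auto elim!: equivE dest: refl_onD)
    then have "l i = c" using c limI unfolding l_def by blast
    then show ?thesis using c that by simp
  qed
  have self: "(i, i) \<in> ?R" for i
    using equiv_recurrently_linked by (auto elim!: equivE dest: refl_onD)
  have "l i = l j" if "(i, j) \<in> ?R" for i j
    using LIMSEQ_unique[OF l[OF that] l[OF self]] .
  then show ?thesis using l[OF self] by blast
qed

text \<open>From time \<open>k\<close> on, each column of the backward product is a trajectory,
  starting at a unit vector since the empty product is the identity.\<close>

lemma backward_prod_limits:
  "\<exists>L. (\<lambda>n. backward_prod A n k) \<longlonglongrightarrow> L \<and> (\<forall>(i, i')\<in>recurrently_linked A. L $ i = L $ i')"
proof -
  have "\<exists>l. (\<forall>i. (\<lambda>n. backward_prod A n k $ i $ j) \<longlonglongrightarrow> l i)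
      \<and> (\<forall>(i, i')\<in>recurrently_linked A. l i = l i')" for j
    using trajectory_limits[of k "\<lambda>n. column j (backward_prod A n k)"]
    by (simp add: column_def matrix_matrix_mult_def matrix_vector_mult_def)
  then have "\<exists>l. \<forall>j. (\<forall>i. (\<lambda>n. backward_prod A n k $ i $ j) \<longlonglongrightarrow> l j i)
      \<and> (\<forall>(i, i')\<in>recurrently_linked A. l j i = l j i')"
    by (intro choice allI)
  then obtain l where l: "\<And>i j. (\<lambda>n. backward_prod A n k $ i $ j) \<longlonglongrightarrow> l j i"
      "\<And>i i' j. (i, i') \<in> recurrently_linked A \<Longrightarrow> l j i = l j i'"
    by blast
  have "(\<lambda>n. backward_prod A n k) \<longlonglongrightarrow> (\<chi> i j. l j i)"
    using l(1) by (intro vec_tendstoI) simp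
  then show ?thesis using l(2) by (intro exI[of _ "\<chi> i j. l j i"]) (auto simp: vec_eq_iff)
qed

end

section \<open>Renumbering by classes\<close>

text \<open>The enumeration is built level by level: the elements of level \<open>m\<close> are
  appended after all lower ones, so each level fills the range between two consecutive cumulative
  counts.\<close>

lemma renumber_by_levels:
  fixes f :: "'a::finite \<Rightarrow> nat"
  shows "\<exists>\<sigma>. bij_betw \<sigma> {1..card {a. f a < m}} {a. f a < m} \<and>
    (\<forall>r<m. \<sigma> ` {card {a. f a < r}<..card {a. f a < Suc r}} = {a. f a = r})"
proof (induction m)
  case 0
  show ?case by (simp add: bij_betw_def)
next
  case (Suc m)
  let ?c = "\<lambda>r. card {a. f a < r}"
  have mono: "?c r \<le> ?c r'" if "r \<le> r'" for r r'
    using that by (intro card_mono) auto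
  have split: "{a. f a < Suc m} = {a. f a < m} \<union> {a. f a = m}" by auto
  then have card_split: "?c (Suc m) = ?c m + card {a. f a = m}"
    by (simp add: card_Un_disjoint disjoint_iff)
  obtain \<sigma> where \<sigma>: "bij_betw \<sigma> {1..?c m} {a. f a < m}"
    "\<And>r. r < m \<Longrightarrow> \<sigma> ` {?c r<..?c (Suc r)} = {a. f a = r}"
    using Suc by blast
  obtain \<tau> where \<tau>: "bij_betw \<tau> {?c m<..?c (Suc m)} {a. f a = m}"
    using finite_same_card_bij[of "{?c m<..?c (Suc m)}" "{a. f a = m}"] card_split by auto
  define \<rho> where "\<rho> p = (if p \<le> ?c m then \<sigma> p else \<tau> p)" for p
  have "bij_betw \<rho> {1..?c m} {a. f a < m}"
    using \<sigma>(1) by (subst bij_betw_cong[where g = \<sigma>]) (auto simp: \<rho>_def)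
  moreover have \<rho>\<tau>: "bij_betw \<rho> {?c m<..?c (Suc m)} {a. f a = m}"
    using \<tau> by (subst bij_betw_cong[where g = \<tau>]) (auto simp: \<rho>_def)
  ultimately have "bij_betw \<rho> ({1..?c m} \<union> {?c m<..?c (Suc m)}) {a. f a < Suc m}"
    unfolding split by (rule bij_betw_combine) auto
  also have "{1..?c m} \<union> {?c m<..?c (Suc m)} = {1..?c (Suc m)}"
    using mono[of m "Suc m"] by auto
  finally have "bij_betw \<rho> {1..?c (Suc m)} {a. f a < Suc m}" .
  moreover have "\<rho> ` {?c r<..?c (Suc r)} = {a. f a = r}" if "r < Suc m" for r
  proof (cases "r = m")
    case True
    then show ?thesis using \<rho>\<tau> by (simp add: bij_betw_def)
  next
    case False
    then have "r < m" using that by simp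
    then have "\<rho> ` {?c r<..?c (Suc r)} = \<sigma> ` {?c r<..?c (Suc r)}"
      using mono[of "Suc r" m] by (intro image_cong) (auto simp: \<rho>_def)
    then show ?thesis using \<sigma>(2) \<open>r < m\<close> by simp
  qed
  ultimately show ?case by blast
qed

text \<open>Number the classes and sort the indices by the number \<open>f\<close> of their class;
  each class then becomes a consecutive range. The boundaries \<open>c\<close> count the indices in
  earlier classes and increase strictly because classes are nonempty.\<close>

lemma equiv_relabels_to_const_row_blocks:
  fixes L :: "real^'s::finite^'s"
  assumes R: "equiv UNIV R"
    and outside: "\<And>i j. (i, j) \<notin> R \<Longrightarrow> L $ i $ j = 0"
    and rows: "\<And>i i'. (i, i') \<in> R \<Longrightarrow> L $ i = L $ i'"
  shows "relabels_to_const_row_blocks L"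
proof -
  define m where "m = card (UNIV // R)"
  obtain h where h: "bij_betw h (UNIV // R) {0..<m}"
    using ex_bij_betw_finite_nat[of "UNIV // R"] unfolding m_def by auto
  define f where "f i = h (R `` {i})" for i
  define c where "c r = card {i. f i < r}" for r
  have in_quot: "R `` {i} \<in> UNIV // R" for i by (rule quotientI) simp
  have f_less: "f i < m" for i
    using bij_betwE[OF h] in_quot unfolding f_def by auto
  have f_eq: "f i = f j \<longleftrightarrow> (i, j) \<in> R" for i j
    using inj_on_eq_iff[OF bij_betw_imp_inj_on[OF h] in_quot in_quot, of i j]
      eq_equiv_class_iff[OF R, of i j] unfolding f_def by simp
  have f_surj: "\<exists>i. f i = r" if "r < m" for r
  proof -
    have "r \<in> h ` (UNIV // R)" using h that by (simp add: bij_betw_def)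
    then show ?thesis unfolding f_def quotient_def by auto
  qed
  obtain \<sigma> where \<sigma>: "bij_betw \<sigma> {1..c m} {i. f i < m}"
    "\<And>r. r < m \<Longrightarrow> \<sigma> ` {c r<..c (Suc r)} = {i. f i = r}"
    using renumber_by_levels[of f m] unfolding c_def by blast
  have "{i. f i < m} = UNIV" using f_less by auto
  then have cm: "c m = CARD('s)" unfolding c_def by simp
  have bij: "bij_betw \<sigma> {1..CARD('s)} UNIV"
    using \<sigma>(1) \<open>{i. f i < m} = UNIV\<close> cm by simp
  have block: "f (\<sigma> p) = r" if "r < m" "p \<in> {c r<..c (Suc r)}" for r p
    using \<sigma>(2)[OF that(1)] that(2) by blast
  have c_mono: "c r \<le> c r'" if "r \<le> r'" for r r'
    using that unfolding c_def by (intro card_mono) auto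
  \<comment> \<open>Being in the image of a range means sharing a value of \<sigma> with a position
    there; injectivity on all positions identifies the two.\<close>
  have block_iff: "p \<in> {c r<..c (Suc r)}" if r: "r < m" and p: "p \<in> {1..CARD('s)}" "f (\<sigma> p) = r" for r p
  proof -
    obtain q where q: "q \<in> {c r<..c (Suc r)}" "\<sigma> p = \<sigma> q"
      using \<sigma>(2)[OF r] p(2) by blast
    have "q \<in> {1..CARD('s)}" using q(1) c_mono[of "Suc r" m] r cm by auto
    then have "p = q" using q(2) p(1) bij by (auto simp: bij_betw_def dest: inj_onD)
    then show ?thesis using q(1) by simp
  qed
  have c_less: "c r < c (Suc r)" if r: "r < m" for r
  proof -
    obtain i where "f i = r" using f_surj[OF r] by blast
    then show ?thesis unfolding c_def by (intro psubset_card_mono) auto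
  qed
  have zero: "L $ \<sigma> p $ \<sigma> q = 0"
    if "r < m" "p \<in> {c r<..c (Suc r)}" "q \<in> {1..CARD('s)} - {c r<..c (Suc r)}" for r p q
    using that block[of r p] block_iff[of r q] f_eq[of "\<sigma> p" "\<sigma> q"] outside by auto
  have const: "L $ \<sigma> p = L $ \<sigma> p'"
    if "r < m" "p \<in> {c r<..c (Suc r)}" "p' \<in> {c r<..c (Suc r)}" for r p p'
    using rows f_eq[of "\<sigma> p" "\<sigma> p'"] block[OF that(1,2)] block[OF that(1,3)] by simp
  have "c 0 = 0" unfolding c_def by simp
  show ?thesis
    unfolding relabels_to_const_row_blocks_def
  proof (intro exI[of _ \<sigma>] exI[of _ m] exI[of _ c] conjI allI impI ballI)
    fix r p p' q
    assume "r < m" "p \<in> {c r<..c (Suc r)}" "p' \<in> {c r<..c (Suc r)}"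
    then show "L $ \<sigma> p $ \<sigma> q = L $ \<sigma> p' $ \<sigma> q" using const by metis
  qed (use bij \<open>c 0 = 0\<close> cm c_less zero in blast)+
qed

section \<open>Class-ergodicity when all links are recurrent\<close>

text \<open>A nonzero entry of a product needs a chain of nonzero entries of the factors.
  Transitivity keeps it inside one class, and reflexivity covers the empty product.\<close>

lemma backward_prod_zero_outside:
  assumes "equiv UNIV R" and "\<And>n i j. A n $ i $ j \<noteq> 0 \<Longrightarrow> (i, j) \<in> R" and "(i, j) \<notin> R"
  shows "backward_prod A n k $ i $ j = 0"
  using assms(3)
proof (induction n arbitrary: i)
  case 0
  then have "i \<noteq> j" using assms(1) by (auto elim!: equivE dest: refl_onD)
  then show ?case by (simp add: mat_def)
next
  case (Suc n)
  have "i \<noteq> j" using Suc.prems assms(1) by (auto elim!: equivE dest: refl_onD)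
  moreover have "(\<Sum>l\<in>UNIV. A n $ i $ l * backward_prod A n k $ l $ j) = 0"
    using Suc assms(1) assms(2)[of n i] by (intro sum.neutral) (auto elim!: equivE dest: transD)
  ultimately show ?case by (simp add: mat_def matrix_matrix_mult_def)
qed

text \<open>The limit has equal rows on each class by \<open>backward_prod_limits\<close>. The
  assumption \<open>linked\<close> covers all times, so that no early link between classes puts
  weight outside the blocks.\<close>

lemma (in symmetric_pattern_chain) class_ergodic_if_recurrently_linked:
  assumes linked: "\<And>n i j. A n $ i $ j \<noteq> 0 \<Longrightarrow> (i, j) \<in> recurrently_linked A"
  shows "class_ergodic A"
  unfolding class_ergodic_def
proof (intro conjI allI)
  fix k
  obtain L where L: "(\<lambda>n. backward_prod A n k) \<longlonglongrightarrow> L"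
    "\<And>i i'. (i, i') \<in> recurrently_linked A \<Longrightarrow> L $ i = L $ i'"
    using backward_prod_limits[of k] by blast
  have "L $ i $ j = 0" if "(i, j) \<notin> recurrently_linked A" for i j
  proof -
    have "(\<lambda>n. backward_prod A n k $ i $ j) \<longlonglongrightarrow> L $ i $ j"
      by (intro tendsto_vec_nth L(1))
    then show ?thesis
      using backward_prod_zero_outside[OF equiv_recurrently_linked linked that]
      by (simp add: LIMSEQ_const_iff)
  qed
  then have "relabels_to_const_row_blocks L"
    using L(2) by (intro equiv_relabels_to_const_row_blocks[OF equiv_recurrently_linked])
  then show "\<exists>L. (\<lambda>n. backward_prod A n k) \<longlonglongrightarrow> L \<and> relabels_to_const_row_blocks L"
    using L(1) by blast
qed (rule stochastic)

section \<open>The JLM model\<close>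

text \<open>This links the matrix to the update rule: \<open>f\<close> constantly 1 yields the row
  sums, and \<open>f\<close> the current state yields the trajectory equation.\<close>

lemma jlm_chain_row:
  fixes D :: "nat \<Rightarrow> 's::finite \<Rightarrow> 's set" and f :: "'s \<Rightarrow> real"
  assumes "i \<notin> D n i"
  shows "(\<Sum>j\<in>UNIV. jlm_chain D n $ i $ j * f j)
    = 1 / (1 + real (card (D n i))) * (f i + (\<Sum>j\<in>D n i. f j))"
proof -
  let ?w = "1 / (1 + real (card (D n i)))"
  have "(\<Sum>j\<in>insert i (D n i). ?w * f j) = (\<Sum>j\<in>UNIV. jlm_chain D n $ i $ j * f j)"
    by (rule sum.mono_neutral_cong_left) (auto simp: jlm_chain_def)
  also have "(\<Sum>j\<in>insert i (D n i). ?w * f j) = ?w * (\<Sum>j\<in>insert i (D n i). f j)"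
    by (simp only: sum_distrib_left)
  also have "(\<Sum>j\<in>insert i (D n i). f j) = f i + (\<Sum>j\<in>D n i. f j)"
    using assms by simp
  finally show ?thesis by simp
qed

text \<open>An agent and its neighbors number at most \<open>CARD('s)\<close>, so each positive
  weight is at least \<open>1 / CARD('s)\<close>; the neighbor relation gives the symmetric
  pattern.\<close>

lemma jlm_symmetric_pattern_chain:
  fixes D :: "nat \<Rightarrow> 's::finite \<Rightarrow> 's set"
  assumes irrefl: "\<And>n i. D n i \<subseteq> UNIV - {i}"
    and sym: "\<And>n i j. j \<in> D n i \<longleftrightarrow> i \<in> D n j"
  shows "symmetric_pattern_chain (jlm_chain D) (1 / CARD('s))"
proof
  have card: "card (insert i (D n i)) = Suc (card (D n i))" for n i
    using irrefl[of n i] by (subst card_insert_disjoint) auto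
  show "row_stochastic (jlm_chain D n)" for n
  proof -
    have "(\<Sum>j\<in>UNIV. jlm_chain D n $ i $ j) = 1" for i
      using jlm_chain_row[of i D n "\<lambda>_. 1"] irrefl[of n i] by auto
    then show ?thesis by (simp add: row_stochastic_def jlm_chain_def)
  qed
  have "Suc (card (D n i)) \<le> CARD('s)" for n i
    using card_mono[of UNIV "insert i (D n i)"] card by simp
  then have weight: "1 / CARD('s) \<le> 1 / (1 + real (card (D n i)))" for n i
    by (intro divide_left_mono) (auto simp flip: of_nat_Suc simp: add_pos_nonneg)
  show "1 / CARD('s) \<le> jlm_chain D n $ i $ i" for n i
    using weight by (simp add: jlm_chain_def)
  show "1 / CARD('s) \<le> jlm_chain D n $ j $ i" if "jlm_chain D n $ i $ j \<noteq> 0" for n i j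
    using weight that sym[of i n j] by (auto simp: jlm_chain_def split: if_splits)
qed simp

lemma jlm_trajectory_step:
  fixes D :: "nat \<Rightarrow> 's::finite \<Rightarrow> 's set"
  assumes irrefl: "\<And>n i. D n i \<subseteq> UNIV - {i}"
    and "jlm_trajectory D k \<theta>" "k \<le> n"
  shows "\<theta> (Suc n) = jlm_chain D n *v \<theta> n"
proof (rule vec_eq_iff[THEN iffD2, rule_format])
  fix i
  show "\<theta> (Suc n) $ i = (jlm_chain D n *v \<theta> n) $ i"
    using assms(2,3) irrefl[of n i] jlm_chain_row[where f = "\<lambda>j. \<theta> n $ j", of i D n]
    unfolding jlm_trajectory_def by (simp add: matrix_vector_mult_def subset_Diff_insert)
qed

text \<open>The limits exist from every starting time. The block form is stated for a tail, since a
  link between different components before it can leave nonzero entries outside the blocks.\<close>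

theorem mainTheorem5:
  fixes D :: "nat \<Rightarrow> 's::finite \<Rightarrow> 's set"
  assumes irrefl: "\<And>n i. D n i \<subseteq> UNIV - {i}"
    and sym: "\<And>n i j. j \<in> D n i \<longleftrightarrow> i \<in> D n j"
  shows "(\<forall>n. row_stochastic (jlm_chain D n)) \<and>
         (\<forall>k. convergent (\<lambda>n. backward_prod (jlm_chain D) n k)) \<and>
         (\<exists>K. class_ergodic (\<lambda>n. jlm_chain D (K + n))) \<and>
         (\<forall>k \<theta>. jlm_trajectory D k \<theta> \<longrightarrow> (\<forall>i. convergent (\<lambda>n. \<theta> n $ i)))"
proof (intro conjI allI impI)
  interpret symmetric_pattern_chain "jlm_chain D" "1 / CARD('s)"
    using assms by (rule jlm_symmetric_pattern_chain)
  show "row_stochastic (jlm_chain D n)" for n by (rule stochastic)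
  show "convergent (\<lambda>n. backward_prod (jlm_chain D) n k)" for k
    using backward_prod_limits[of k] by (auto simp: convergent_def)
  show "\<exists>K. class_ergodic (\<lambda>n. jlm_chain D (K + n))"
  proof -
    \<comment> \<open>From \<open>K\<close> on, every link stays inside a class of the whole chain;
      \<open>recurrently_linked_shift\<close> turns these classes into those of the tail.\<close>
    obtain K where K: "\<And>n i j. K \<le> n \<Longrightarrow> jlm_chain D n $ i $ j \<noteq> 0 \<Longrightarrow>
        (i, j) \<in> recurrently_linked (jlm_chain D)"
      using eventually_recurrently_linked by blast
    interpret tail: symmetric_pattern_chain "\<lambda>n. jlm_chain D (K + n)" "1 / CARD('s)"
      by (rule shift)
    have "class_ergodic (\<lambda>n. jlm_chain D (K + n))"
      by (rule tail.class_ergodic_if_recurrently_linked) (auto simp: recurrently_linked_shift intro: K[OF le_add1])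
    then show ?thesis ..
  qed
  show "convergent (\<lambda>n. \<theta> n $ i)" if "jlm_trajectory D k \<theta>" for k \<theta> i
    using trajectory_limits[of k \<theta>] jlm_trajectory_step[OF irrefl that]
    by (auto simp: convergent_def)
qed

end
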